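(* Let $\mu>0$ and assume that $A_\xi:\mathcal{X}\to 2^{\mathcal{X}}$ is $\mu$-strongly maximally monotone for every $\xi\sim\mathcal{D}$, so that $A:=\mathrm{E}_{\xi\sim\mathcal{D}}[A_\xi]$ is $\mu$-strongly maximally monotone as well and the solution $x^\star$ of $0\in A(x^\star)$ exists and is unique (these consequences are part of the assumption). Assume moreover that expected similarity holds with constant $\delta>0$: for every $x\in\mathcal{X}$ and every family $a_\xi\in A_\xi(x)$, $\xi\sim\mathcal{D}$, there exists a family $a_\xi^\star\in A_\xi(x^\star)$, $\xi\sim\mathcal{D}$, such that $\mathrm{E}_{\xi\sim\mathcal{D}}[a_\xi^\star]=0$ and $$\mathrm{E}_{\xi\sim\mathcal{D}}\left[\left\|a_\xi-\mathrm{E}_{\xi'\sim\mathcal{D}}[a_{\xi'}]-a_\xi^\star\right\|^2\right]\le\delta^2\|x-x^\star\|^2.$$ Let $(x^k)_{k\ge0}$ be generated by the algorithm SPPM-OC described in the context, with any stepsize $\gamma>0$ and any initial estimate $x^0\in\mathcal{X}$. Then, for every $k\ge0$, $$\mathrm{E}\left[\|x^k-x^\star\|^2\right]\le\left(\frac{1+\gamma^2\delta^2}{(1+\gamma\mu)^2}\right)^k\|x^0-x^\star\|^2.$$ Moreover, $x^k$ converges to $x^\star$ almost surely.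
   Context: $\mathcal{X}$ is a finite-dimensional real Hilbert space with inner product $\langle\cdot,\cdot\rangle$ and norm $\|\cdot\|$; $I$ is the identity; $\mathcal{D}$ is a probability distribution. A set-valued operator $B:\mathcal{X}\to 2^{\mathcal{X}}$ has graph $\mathrm{gra}(B)=\{(x,u):u\in B(x)\}$. $B$ is monotone if $\langle u-v,x-y\rangle\ge 0$ for all $(x,u),(y,v)\in\mathrm{gra}(B)$; maximally monotone if moreover no monotone operator has a graph strictly containing $\mathrm{gra}(B)$; $\mu$-strongly maximally monotone if it is maximally monotone and $\langle u-v,x-y\rangle\ge\mu\|x-y\|^2$ for all $(x,u),(y,v)\in\mathrm{gra}(B)$. If $B$ is maximally monotone, the resolvent $(I+B)^{-1}$ is defined everywhere and single-valued. The operator $A=\mathrm{E}_{\xi\sim\mathcal{D}}[A_\xi]$ is understood through selections: $u\in A(x)$ if and only if there is a family $a_\xi\in A_\xi(x)$ with $\mathrm{E}_{\xi\sim\mathcal{D}}[a_\xi]=u$. All families (selections) are implicitly measurable and integrable in $\xi$. Algorithm SPPM-OC (Stochastic Proximal Point Method with Operator Correction), with stepsize $\gamma>0$ and initial estimate $x^0\in\mathcal{X}$: for $k=0,1,\ldots$ 1. sample $\xi^k\sim\mathcal{D}$ (independently of the past); 2. choose $a^k_{\xi^k}\in A_{\xi^k}(x^k)$ and $a^k\in A(x^k)$ so that $a^k=\mathrm{E}_{\xi\sim\mathcal{D}}[a_\xi^k]$, where $a_\xi^k\in A_\xi(x^k)$ (the family $(a_\xi^k)_\xi$ depends only on the past,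 not on $\xi^k$); 3. set $h^k:=a_{\xi^k}^k-a^k$; 4. set $x^{k+1}:=(I+\gamma A_{\xi^k})^{-1}(x^k+\gamma h^k)$. It is implicit that the choices in step 2 are possible and measurable.
   Formalization: Almost sure convergence is claimed only when (1+γ²δ²)/(1+γμ)² < 1; as stated for any stepsize γ>0 it is false (for a ratio ≥ 1 the iterates can stay at distance 1 from x* ). The mean-square bound is for every γ>0. *)

theory Defs
  imports "HOL-Probability.Probability"
begin

definition gra :: "('a \<Rightarrow> 'a set) \<Rightarrow> ('a \<times> 'a) set" where
  "gra B = {(x, u). u \<in> B x}"

definition monotone_op :: "('a::real_inner \<Rightarrow> 'a set) \<Rightarrow> bool" where
  "monotone_op B \<longleftrightarrow>
     (\<forall>(x, u) \<in> gra B. \<forall>(y, v) \<in> gra B. 0 \<le> (u - v) \<bullet> (x - y))"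

definition maximally_monotone :: "('a::real_inner \<Rightarrow> 'a set) \<Rightarrow> bool" where
  "maximally_monotone B \<longleftrightarrow>
     monotone_op B \<and> (\<forall>C. monotone_op C \<longrightarrow> \<not> gra B \<subset> gra C)"

definition strongly_maximally_monotone :: "real \<Rightarrow> ('a::real_inner \<Rightarrow> 'a set) \<Rightarrow> bool" where
  "strongly_maximally_monotone \<mu> B \<longleftrightarrow>
     maximally_monotone B \<and>
     (\<forall>(x, u) \<in> gra B. \<forall>(y, v) \<in> gra B. \<mu> * (norm (x - y))\<^sup>2 \<le> (u - v) \<bullet> (x - y))"

definition scale_op :: "real \<Rightarrow> ('a::real_vector \<Rightarrow> 'a set) \<Rightarrow> 'a \<Rightarrow> 'a set" where
  "scale_op \<gamma> B x = (\<lambda>u. \<gamma> *\<^sub>R u) ` B x"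

text \<open>The resolvent \<open>(I + B)\<^sup>-\<^sup>1\<close> is the inverse of the set-valued operator \<open>I + B\<close> and hence
  set-valued itself.  For maximally monotone \<open>B\<close> each of its values is a singleton, so that
  \<open>x \<in> resolvent B y\<close> says that \<open>x\<close> is the value of the resolvent at \<open>y\<close>.\<close>

definition resolvent :: "('a::real_vector \<Rightarrow> 'a set) \<Rightarrow> 'a \<Rightarrow> 'a set" where
  "resolvent B y = {x. \<exists>u \<in> B x. x + u = y}"

lemma resolvent_unique:
  assumes "monotone_op B" and "x \<in> resolvent B y" and "x' \<in> resolvent B y"
  shows "x = x'"
proof -
  from assms(2,3) obtain u u' where u: "u \<in> B x" "x + u = y" "u' \<in> B x'" "x' + u' = y"
    by (auto simp: resolvent_def)
  have "0 \<le> (u - u') \<bullet> (x - x')"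
    using assms(1) u by (auto simp: monotone_op_def gra_def)
  moreover have "u - u' = - (x - x')"
    using u by (simp add: algebra_simps)
  ultimately have "(x - x') \<bullet> (x - x') \<le> 0"
    by (metis inner_minus_left neg_0_le_iff_le)
  then have "(x - x') \<bullet> (x - x') = 0"
    by (meson inner_ge_zero order_antisym)
  then show ?thesis by simp
qed

text \<open>A family \<open>a\<^sub>\<xi> \<in> A\<^sub>\<xi>(x)\<close>; integrability over \<open>D\<close> includes measurability.\<close>

definition selection ::
    "'b measure \<Rightarrow> ('b \<Rightarrow> 'a \<Rightarrow> 'a set) \<Rightarrow> 'a::euclidean_space \<Rightarrow> ('b \<Rightarrow> 'a) \<Rightarrow> bool" where
  "selection D A x a \<longleftrightarrow> integrable D a \<and> (\<forall>s \<in> space D. a s \<in> A s x)"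

definition expected_op ::
    "'b measure \<Rightarrow> ('b \<Rightarrow> 'a \<Rightarrow> 'a set) \<Rightarrow> 'a::euclidean_space \<Rightarrow> 'a set" where
  "expected_op D A x = {u. \<exists>a. selection D A x a \<and> (\<integral>s. a s \<partial>D) = u}"

text \<open>The inequality on the (Bochner) integral is paired with integrability, because the
  integral of a non-integrable function is \<open>0\<close>.\<close>

definition expected_similarity ::
    "'b measure \<Rightarrow> ('b \<Rightarrow> 'a \<Rightarrow> 'a set) \<Rightarrow> 'a::euclidean_space \<Rightarrow> real \<Rightarrow> bool" where
  "expected_similarity D A xstar \<delta> \<longleftrightarrow>
     (\<forall>x a. selection D A x a \<longrightarrow>
        (\<exists>astar. selection D A xstar astar \<and> (\<integral>s. astar s \<partial>D) = 0 \<and>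
           integrable D (\<lambda>s. (norm (a s - (\<integral>t. a t \<partial>D) - astar s))\<^sup>2) \<and>
           (\<integral>s. (norm (a s - (\<integral>t. a t \<partial>D) - astar s))\<^sup>2 \<partial>D) \<le> \<delta>\<^sup>2 * (norm (x - xstar))\<^sup>2))"

text \<open>A run of the method on the probability space \<open>M\<close>.  The \<open>\<sigma>\<close>-algebra \<open>F k\<close> is the past at
  step \<open>k\<close>: it contains the information about the samples \<open>\<xi> 0, \<dots>, \<xi> (k - 1)\<close> and possibly
  further randomness used for choosing the selections.  The family \<open>a k \<omega>\<close> is the selection
  chosen at step \<open>k\<close>, so that \<open>a k \<omega> (\<xi> k \<omega>) - (\<integral>t. a k \<omega> t \<partial>D)\<close> is the correction \<open>h\<^sup>k\<close>.
  In the last assumption, \<open>T (\<omega>, s)\<close> is the next iterate when the fresh sample is \<open>s\<close>; its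
  values are determined by \<open>resolvent_unique\<close>, and the assumption requires them to depend
  jointly measurably on the past and the sample.\<close>

locale sppm_oc = prob_space M + filtration "space M" F
  for M :: "'w measure" and F :: "nat \<Rightarrow> 'w measure" +
  fixes D :: "'b measure"
    and A :: "'b \<Rightarrow> 'a::euclidean_space \<Rightarrow> 'a set"
    and \<gamma> :: real
    and x0 :: 'a
    and \<xi> :: "nat \<Rightarrow> 'w \<Rightarrow> 'b"
    and a :: "nat \<Rightarrow> 'w \<Rightarrow> 'b \<Rightarrow> 'a"
    and x :: "nat \<Rightarrow> 'w \<Rightarrow> 'a"
  assumes F_subalgebra: "\<And>k. subalgebra M (F k)"
    and sample_adapted: "\<And>k. \<xi> k \<in> F (Suc k) \<rightarrow>\<^sub>M D"
    and sample_distr: "\<And>k. distr M D (\<xi> k) = D"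
    and sample_indep: "\<And>k. indep_set (sets (F k)) {\<xi> k -` E \<inter> space M | E. E \<in> sets D}"
    and selection_measurable:
      "\<And>k. (\<lambda>(\<omega>, s). a k \<omega> s) \<in> borel_measurable (F k \<Otimes>\<^sub>M D)"
    and selection_step: "\<And>k \<omega>. \<omega> \<in> space M \<Longrightarrow> selection D A (x k \<omega>) (a k \<omega>)"
    and initial: "\<And>\<omega>. \<omega> \<in> space M \<Longrightarrow> x 0 \<omega> = x0"
    and iterate_step: "\<And>k. \<exists>T \<in> borel_measurable (F k \<Otimes>\<^sub>M D).
        (\<forall>\<omega> \<in> space M. \<forall>s \<in> space D.
           T (\<omega>, s) \<in> resolvent (scale_op \<gamma> (A s))
             (x k \<omega> + \<gamma> *\<^sub>R (a k \<omega> s - (\<integral>t. a k \<omega> t \<partial>D)))) \<and>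
        (\<forall>\<omega> \<in> space M. x (Suc k) \<omega> = T (\<omega>, \<xi> k \<omega>))"

end

theory Submission
  imports Defs
begin

text \<open>If \<open>p\<close> is the value of \<open>(I + \<gamma> A\<^sub>\<xi>)\<^sup>-\<^sup>1\<close> at \<open>x\<^sup>k + \<gamma> h\<^sup>k\<close>, then \<open>x\<^sup>\<star>\<close> is its value at
  \<open>x\<^sup>\<star> + \<gamma> a\<^sub>\<xi>\<^sup>\<star>\<close>, and strong monotonicity makes the resolvent a contraction with factor
  \<open>1 / (1 + \<gamma> \<mu>)\<close>.  With the zero-mean error \<open>d = h\<^sup>k - a\<^sub>\<xi>\<^sup>\<star>\<close>, the cross term of
  \<open>\<parallel>x\<^sup>k - x\<^sup>\<star> + \<gamma> d\<parallel>\<^sup>2\<close> vanishes in expectation and expected similarity bounds the quadratic one,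
  so the mean squared error contracts conditionally on the past.  When the rate is below \<open>1\<close>, the
  expectations are summable, hence so are the squared errors almost surely.\<close>

section \<open>One proximal step with the past held fixed\<close>

text \<open>Pairing \<open>y - z = (p - q) + \<gamma> *\<^sub>R (u - v)\<close> with
  \<open>p - q\<close> turns strong monotonicity into a lower bound for
  \<open>(y - z) \<bullet> (p - q)\<close>; Cauchy-Schwarz then allows one factor
  \<open>norm (p - q)\<close> to be cancelled.\<close>

lemma resolvent_contraction:
  fixes B :: "'a::real_inner \<Rightarrow> 'a set"
  assumes "strongly_maximally_monotone \<mu> B" and "0 < \<gamma>" and "0 < \<mu>"
    and "p \<in> resolvent (scale_op \<gamma> B) y" and "q \<in> resolvent (scale_op \<gamma> B) z"
  shows "(1 + \<gamma> * \<mu>)\<^sup>2 * (norm (p - q))\<^sup>2 \<le> (norm (y - z))\<^sup>2"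
proof -
  obtain u v where u: "u \<in> B p" "p + \<gamma> *\<^sub>R u = y" and v: "v \<in> B q" "q + \<gamma> *\<^sub>R v = z"
    using assms(4,5) by (auto simp: resolvent_def scale_op_def)
  have "\<mu> * (norm (p - q))\<^sup>2 \<le> (u - v) \<bullet> (p - q)"
    using assms(1) u v by (auto simp: strongly_maximally_monotone_def gra_def)
  then have "\<gamma> * (\<mu> * (norm (p - q))\<^sup>2) \<le> \<gamma> * ((u - v) \<bullet> (p - q))"
    using assms(2) by (intro mult_left_mono) auto
  moreover have "y - z = (p - q) + \<gamma> *\<^sub>R (u - v)"
    using u v by (auto simp: algebra_simps)
  ultimately have "(1 + \<gamma> * \<mu>) * (norm (p - q))\<^sup>2 \<le> (y - z) \<bullet> (p - q)"
    by (simp add: inner_add_left power2_norm_eq_inner distrib_right mult.assoc)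
  also have "\<dots> \<le> norm (y - z) * norm (p - q)"
    by (rule norm_cauchy_schwarz)
  finally have "(1 + \<gamma> * \<mu>) * norm (p - q) * norm (p - q) \<le> norm (y - z) * norm (p - q)"
    by (simp add: power2_eq_square mult.assoc)
  then have "(1 + \<gamma> * \<mu>) * norm (p - q) \<le> norm (y - z)"
    by (cases "norm (p - q) = 0") (auto simp: mult_le_cancel_right)
  then have "((1 + \<gamma> * \<mu>) * norm (p - q))\<^sup>2 \<le> (norm (y - z))\<^sup>2"
    using assms(2,3) by (intro power_mono) auto
  then show ?thesis
    by (simp add: power_mult_distrib)
qed

text \<open>Here \<open>z\<close> and \<open>b\<close> stand for the iterate and the selection at
  one fixed outcome, and \<open>t\<close> for the next iterate as a function of the fresh sample.
  With a nonnegative integral on the left, monotonicity applies without any measurability of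
  \<open>t\<close>.\<close>

lemma expected_step_contraction:
  fixes A :: "'b \<Rightarrow> 'a::euclidean_space \<Rightarrow> 'a set"
  assumes "prob_space D"
    and mono: "\<And>s. s \<in> space D \<Longrightarrow> strongly_maximally_monotone \<mu> (A s)"
    and sim: "expected_similarity D A xstar \<delta>"
    and "0 < \<mu>" and "0 < \<gamma>"
    and sel: "selection D A z b"
    and step: "\<And>s. s \<in> space D \<Longrightarrow>
      t s \<in> resolvent (scale_op \<gamma> (A s)) (z + \<gamma> *\<^sub>R (b s - (\<integral>r. b r \<partial>D)))"
  shows "(\<integral>\<^sup>+s. ennreal ((norm (t s - xstar))\<^sup>2) \<partial>D)
    \<le> ennreal ((1 + \<gamma>\<^sup>2 * \<delta>\<^sup>2) / (1 + \<gamma> * \<mu>)\<^sup>2 * (norm (z - xstar))\<^sup>2)"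
proof -
  interpret D: prob_space D by fact
  define c where "c = (1 + \<gamma> * \<mu>)\<^sup>2"
  have "c > 0"
    unfolding c_def using assms(4,5) by (intro zero_less_power add_pos_pos mult_pos_pos) auto
  obtain astar where selstar: "selection D A xstar astar" and mean: "(\<integral>s. astar s \<partial>D) = 0"
    and int2: "integrable D (\<lambda>s. (norm (b s - (\<integral>r. b r \<partial>D) - astar s))\<^sup>2)"
    and le: "(\<integral>s. (norm (b s - (\<integral>r. b r \<partial>D) - astar s))\<^sup>2 \<partial>D) \<le> \<delta>\<^sup>2 * (norm (z - xstar))\<^sup>2"
    using sim sel unfolding expected_similarity_def by blast
  define d where "d s = b s - (\<integral>r. b r \<partial>D) - astar s" for s
  \<comment> \<open>\<open>g s\<close> is the expanded squared distance between the two resolvent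
    arguments. Its middle term is linear in \<open>d\<close>, which has mean 0 because both the
    centred \<open>b\<close> and \<open>astar\<close> do.\<close>
  define g where "g s = (norm (z - xstar))\<^sup>2 + 2 * \<gamma> * ((z - xstar) \<bullet> d s) + \<gamma>\<^sup>2 * (norm (d s))\<^sup>2" for s
  have [simp]: "integrable D b" "integrable D astar"
    using sel selstar by (auto simp: selection_def)
  have d: "integrable D d" "(\<integral>s. d s \<partial>D) = 0"
    using mean by (simp_all add: d_def[abs_def] D.prob_space)
  have d2: "integrable D (\<lambda>s. (norm (d s))\<^sup>2)"
    using int2 by (simp add: d_def)
  have g: "integrable D g"
    unfolding g_def using d d2 by auto
  have g_eq: "g s = (norm (z + \<gamma> *\<^sub>R (b s - (\<integral>r. b r \<partial>D)) - (xstar + \<gamma> *\<^sub>R astar s)))\<^sup>2" for s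
  proof -
    have "z + \<gamma> *\<^sub>R (b s - (\<integral>r. b r \<partial>D)) - (xstar + \<gamma> *\<^sub>R astar s) = (z - xstar) + \<gamma> *\<^sub>R d s"
      by (simp add: d_def algebra_simps)
    also have "(norm \<dots>)\<^sup>2 = g s"
      unfolding g_def power2_norm_eq_inner inner_add_left inner_add_right
      by (simp add: inner_commute power2_eq_square)
    finally show ?thesis by simp
  qed
  have pointwise: "(norm (t s - xstar))\<^sup>2 \<le> g s / c" if "s \<in> space D" for s
  proof -
    have "xstar \<in> resolvent (scale_op \<gamma> (A s)) (xstar + \<gamma> *\<^sub>R astar s)"
      using selstar that by (auto simp: resolvent_def scale_op_def selection_def)
    from resolvent_contraction[OF mono[OF that] assms(5,4) step[OF that] this]
    show ?thesis
      using \<open>c > 0\<close> by (simp add: g_eq c_def pos_le_divide_eq mult.commute)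
  qed
  have "(\<integral>\<^sup>+s. ennreal ((norm (t s - xstar))\<^sup>2) \<partial>D) \<le> (\<integral>\<^sup>+s. ennreal (g s / c) \<partial>D)"
    by (intro nn_integral_mono ennreal_leI pointwise)
  also have "\<dots> = ennreal (\<integral>s. g s / c \<partial>D)"
  proof (rule nn_integral_eq_integral)
    show "integrable D (\<lambda>s. g s / c)"
      using g by simp
    show "AE s in D. 0 \<le> g s / c"
      using \<open>c > 0\<close> by (simp add: g_eq)
  qed
  also have "\<dots> \<le> ennreal ((1 + \<gamma>\<^sup>2 * \<delta>\<^sup>2) / c * (norm (z - xstar))\<^sup>2)"
  proof (rule ennreal_leI)
    have "(\<integral>s. g s \<partial>D) = (norm (z - xstar))\<^sup>2 + \<gamma>\<^sup>2 * (\<integral>s. (norm (d s))\<^sup>2 \<partial>D)"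
      unfolding g_def using d d2 by (simp add: D.prob_space)
    also have "\<dots> \<le> (norm (z - xstar))\<^sup>2 + \<gamma>\<^sup>2 * (\<delta>\<^sup>2 * (norm (z - xstar))\<^sup>2)"
      using le by (intro add_left_mono mult_left_mono) (auto simp: d_def)
    finally show "(\<integral>s. g s / c \<partial>D) \<le> (1 + \<gamma>\<^sup>2 * \<delta>\<^sup>2) / c * (norm (z - xstar))\<^sup>2"
      using \<open>c > 0\<close> by (simp add: divide_right_mono algebra_simps)
  qed
  finally show ?thesis
    by (simp add: c_def)
qed

section \<open>Integrating out a sample independent of the past\<close>

text \<open>By independence, the joint law of the past and the sample is a product measure, so
  Tonelli lets the sample be averaged first with the past frozen. This replaces conditional
  expectations.\<close>

lemma (in prob_space) nn_integral_indep_sample: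
  assumes F: "subalgebra M F" and "X \<in> M \<rightarrow>\<^sub>M D" and "distr M D X = D" and "prob_space D"
    and indep: "indep_set (sets F) {X -` E \<inter> space M | E. E \<in> sets D}"
    and f: "f \<in> borel_measurable (F \<Otimes>\<^sub>M D)"
  shows "(\<integral>\<^sup>+\<omega>. f (\<omega>, X \<omega>) \<partial>M) = (\<integral>\<^sup>+\<omega>. (\<integral>\<^sup>+s. f (\<omega>, s) \<partial>D) \<partial>M)"
proof -
  interpret D: prob_space D by fact
  \<comment> \<open>As a map into the coarser \<sigma>-algebra, the identity pushes \<open>M\<close>
    forward to its restriction to the past.\<close>
  have id: "(\<lambda>\<omega>. \<omega>) \<in> M \<rightarrow>\<^sub>M F"
    using F by (auto simp: measurable_def subalgebra_def sets.Int_space_eq2)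
  have pair: "(\<lambda>\<omega>. (\<omega>, X \<omega>)) \<in> M \<rightarrow>\<^sub>M F \<Otimes>\<^sub>M D"
    using id assms(2) by (rule measurable_Pair)
  interpret F: prob_space "distr M F (\<lambda>\<omega>. \<omega>)"
    using id by (rule prob_space_distr)
  have distr_pair: "distr M F (\<lambda>\<omega>. \<omega>) \<Otimes>\<^sub>M D = distr M (F \<Otimes>\<^sub>M D) (\<lambda>\<omega>. (\<omega>, X \<omega>))"
  \<comment> \<open>It suffices to compare the measures on rectangles \<open>B \<times> E\<close>,
    where independence gives the product.\<close>
  proof (rule pair_measure_eqI)
    show "sigma_finite_measure (distr M F (\<lambda>\<omega>. \<omega>))" "sigma_finite_measure D"
      by unfold_locales
    show "sets (distr M F (\<lambda>\<omega>. \<omega>) \<Otimes>\<^sub>M D) = sets (distr M (F \<Otimes>\<^sub>M D) (\<lambda>\<omega>. (\<omega>, X \<omega>)))"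
      unfolding sets_distr by (intro sets_pair_measure_cong) auto
    fix B E assume "B \<in> sets (distr M F (\<lambda>\<omega>. \<omega>))" and E: "E \<in> sets D"
    then have B: "B \<in> sets F" "B \<in> sets M" "B \<subseteq> space M"
      using F sets.sets_into_space[of B F] by (auto simp: subalgebra_def)
    have "emeasure (distr M F (\<lambda>\<omega>. \<omega>)) B = prob B"
      using B id by (simp add: emeasure_distr emeasure_eq_measure Int_absorb2)
    moreover have "emeasure D E = prob (X -` E \<inter> space M)"
      by (subst assms(3)[symmetric]) (use E assms(2) in \<open>simp add: emeasure_distr emeasure_eq_measure\<close>)
    moreover have "emeasure (distr M (F \<Otimes>\<^sub>M D) (\<lambda>\<omega>. (\<omega>, X \<omega>))) (B \<times> E) = prob (B \<inter> (X -` E \<inter> space M))"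
    proof -
      have "(\<lambda>\<omega>. (\<omega>, X \<omega>)) -` (B \<times> E) \<inter> space M = B \<inter> (X -` E \<inter> space M)"
        by auto
      then show ?thesis
        using B E by (simp add: emeasure_distr[OF pair] emeasure_eq_measure)
    qed
    moreover have "prob (B \<inter> (X -` E \<inter> space M)) = prob B * prob (X -` E \<inter> space M)"
      using B E by (intro indep_setD[OF indep]) auto
    ultimately show "emeasure (distr M F (\<lambda>\<omega>. \<omega>)) B * emeasure D E
        = emeasure (distr M (F \<Otimes>\<^sub>M D) (\<lambda>\<omega>. (\<omega>, X \<omega>))) (B \<times> E)"
      by (simp add: ennreal_mult)
  qed
  \<comment> \<open>Tonelli is stated for the restricted measure, which has the same measurable sets
    as \<open>F\<close>; measurability of \<open>f\<close> is carried over along this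
    equality.\<close>
  have "sets (distr M F (\<lambda>\<omega>. \<omega>) \<Otimes>\<^sub>M D) = sets (F \<Otimes>\<^sub>M D)"
    by (intro sets_pair_measure_cong) auto
  from measurable_cong_sets[OF this refl] f
  have f': "f \<in> borel_measurable (distr M F (\<lambda>\<omega>. \<omega>) \<Otimes>\<^sub>M D)"
    by (rule equalityD2[THEN subsetD])
  have "(\<integral>\<^sup>+\<omega>. f (\<omega>, X \<omega>) \<partial>M) = (\<integral>\<^sup>+y. f y \<partial>distr M (F \<Otimes>\<^sub>M D) (\<lambda>\<omega>. (\<omega>, X \<omega>)))"
    using f pair by (simp add: nn_integral_distr)
  also have "\<dots> = (\<integral>\<^sup>+\<omega>. (\<integral>\<^sup>+s. f (\<omega>, s) \<partial>D) \<partial>distr M F (\<lambda>\<omega>. \<omega>))"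
    unfolding distr_pair[symmetric] by (intro D.nn_integral_fst[symmetric] f')
  also have "\<dots> = (\<integral>\<^sup>+\<omega>. (\<integral>\<^sup>+s. f (\<omega>, s) \<partial>D) \<partial>M)"
    by (intro nn_integral_distr id D.borel_measurable_nn_integral_fst f')
  finally show ?thesis .
qed

section \<open>Recursion for the mean squared error\<close>

lemma (in sppm_oc) sample_measurable: "\<xi> k \<in> M \<rightarrow>\<^sub>M D"
  using measurable_from_subalg[OF F_subalgebra sample_adapted] .

text \<open>The locale does not assume this directly: the initial iterate is constant, and each
  later one is the jointly measurable \<open>T\<close> composed with the pair of outcome and
  sample.\<close>

lemma (in sppm_oc) iterate_measurable: "x k \<in> borel_measurable M"
proof (cases k)
  case 0
  then show ?thesis
    using initial by (simp cong: measurable_cong)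
next
  case (Suc j)
  obtain T where T: "T \<in> borel_measurable (F j \<Otimes>\<^sub>M D)"
    and x: "\<And>\<omega>. \<omega> \<in> space M \<Longrightarrow> x (Suc j) \<omega> = T (\<omega>, \<xi> j \<omega>)"
    using iterate_step[of j] by auto
  have "(\<lambda>\<omega>. (\<omega>, \<xi> j \<omega>)) \<in> M \<rightarrow>\<^sub>M F j \<Otimes>\<^sub>M D"
    by (intro measurable_Pair sample_measurable
        measurable_from_subalg[OF F_subalgebra[of j]] measurable_ident_sets refl)
  from measurable_compose[OF this T] show ?thesis
    using Suc x by (simp cong: measurable_cong)
qed

text \<open>\<open>T\<close> separates the dependence on the past from that on the fresh sample, so
  the sample can be integrated out and the one-step bound applied at each fixed outcome.\<close>

lemma (in sppm_oc) nn_integral_error_Suc: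
  assumes "prob_space D"
    and "\<And>s. s \<in> space D \<Longrightarrow> strongly_maximally_monotone \<mu> (A s)"
    and "expected_similarity D A xstar \<delta>"
    and "0 < \<mu>" and "0 < \<gamma>"
  shows "(\<integral>\<^sup>+\<omega>. ennreal ((norm (x (Suc k) \<omega> - xstar))\<^sup>2) \<partial>M)
    \<le> ennreal ((1 + \<gamma>\<^sup>2 * \<delta>\<^sup>2) / (1 + \<gamma> * \<mu>)\<^sup>2) * (\<integral>\<^sup>+\<omega>. ennreal ((norm (x k \<omega> - xstar))\<^sup>2) \<partial>M)"
proof -
  obtain T where T: "T \<in> borel_measurable (F k \<Otimes>\<^sub>M D)"
    and res: "\<And>\<omega> s. \<omega> \<in> space M \<Longrightarrow> s \<in> space D \<Longrightarrow>
      T (\<omega>, s) \<in> resolvent (scale_op \<gamma> (A s)) (x k \<omega> + \<gamma> *\<^sub>R (a k \<omega> s - (\<integral>t. a k \<omega> t \<partial>D)))"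
    and x: "\<And>\<omega>. \<omega> \<in> space M \<Longrightarrow> x (Suc k) \<omega> = T (\<omega>, \<xi> k \<omega>)"
    using iterate_step[of k] by auto
  have "(\<integral>\<^sup>+\<omega>. ennreal ((norm (x (Suc k) \<omega> - xstar))\<^sup>2) \<partial>M)
      = (\<integral>\<^sup>+\<omega>. ennreal ((norm (T (\<omega>, \<xi> k \<omega>) - xstar))\<^sup>2) \<partial>M)"
    by (intro nn_integral_cong) (simp add: x)
  also have "\<dots> = (\<integral>\<^sup>+\<omega>. (\<integral>\<^sup>+s. ennreal ((norm (T (\<omega>, s) - xstar))\<^sup>2) \<partial>D) \<partial>M)"
    using T by (intro nn_integral_indep_sample[OF F_subalgebra sample_measurable sample_distr
          assms(1) sample_indep, where f = "\<lambda>y. ennreal ((norm (T y - xstar))\<^sup>2)"])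
      (rule measurable_compose[OF T], measurable)
  also have "\<dots> \<le> (\<integral>\<^sup>+\<omega>. ennreal ((1 + \<gamma>\<^sup>2 * \<delta>\<^sup>2) / (1 + \<gamma> * \<mu>)\<^sup>2 * (norm (x k \<omega> - xstar))\<^sup>2) \<partial>M)"
    by (intro nn_integral_mono expected_step_contraction[OF assms selection_step res])
  also have "\<dots> = ennreal ((1 + \<gamma>\<^sup>2 * \<delta>\<^sup>2) / (1 + \<gamma> * \<mu>)\<^sup>2)
      * (\<integral>\<^sup>+\<omega>. ennreal ((norm (x k \<omega> - xstar))\<^sup>2) \<partial>M)"
    using iterate_measurable[of k]
    by (subst nn_integral_cmult[symmetric]) (auto simp flip: ennreal_mult)
  finally show ?thesis .
qed

text \<open>The induction stays in the extended nonnegative reals, so integrability of the errors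
  can be read off from the result.\<close>

lemma (in sppm_oc) nn_integral_error_le:
  assumes "prob_space D"
    and "\<And>s. s \<in> space D \<Longrightarrow> strongly_maximally_monotone \<mu> (A s)"
    and "expected_similarity D A xstar \<delta>"
    and "0 < \<mu>" and "0 < \<gamma>"
  shows "(\<integral>\<^sup>+\<omega>. ennreal ((norm (x k \<omega> - xstar))\<^sup>2) \<partial>M)
    \<le> ennreal (((1 + \<gamma>\<^sup>2 * \<delta>\<^sup>2) / (1 + \<gamma> * \<mu>)\<^sup>2) ^ k * (norm (x0 - xstar))\<^sup>2)"
proof (induction k)
  case 0
  have "(\<integral>\<^sup>+\<omega>. ennreal ((norm (x 0 \<omega> - xstar))\<^sup>2) \<partial>M)
      = (\<integral>\<^sup>+\<omega>. ennreal ((norm (x0 - xstar))\<^sup>2) \<partial>M)"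
    by (intro nn_integral_cong) (simp add: initial)
  then show ?case
    by (simp add: emeasure_space_1)
next
  case (Suc k)
  define \<rho> where "\<rho> = (1 + \<gamma>\<^sup>2 * \<delta>\<^sup>2) / (1 + \<gamma> * \<mu>)\<^sup>2"
  have "\<rho> \<ge> 0" by (simp add: \<rho>_def)
  have "(\<integral>\<^sup>+\<omega>. ennreal ((norm (x (Suc k) \<omega> - xstar))\<^sup>2) \<partial>M)
      \<le> ennreal \<rho> * (\<integral>\<^sup>+\<omega>. ennreal ((norm (x k \<omega> - xstar))\<^sup>2) \<partial>M)"
    unfolding \<rho>_def by (rule nn_integral_error_Suc[OF assms])
  also have "\<dots> \<le> ennreal \<rho> * ennreal (\<rho> ^ k * (norm (x0 - xstar))\<^sup>2)"
    using Suc by (intro mult_left_mono) (auto simp: \<rho>_def)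
  also have "\<dots> = ennreal (\<rho> ^ Suc k * (norm (x0 - xstar))\<^sup>2)"
    using \<open>\<rho> \<ge> 0\<close> by (simp flip: ennreal_mult add: mult.assoc)
  finally show ?case
    by (simp add: \<rho>_def)
qed

section \<open>Almost sure convergence\<close>

text \<open>Exchanging sum and integral gives the series of the \<open>f k\<close> a finite
  integral. It is therefore finite almost everywhere, and its terms tend to 0.\<close>

lemma AE_tendsto_zero_if_integral_geometric:
  fixes f :: "nat \<Rightarrow> 'w \<Rightarrow> real"
  assumes "\<And>k. f k \<in> borel_measurable M" and "\<And>k \<omega>. 0 \<le> f k \<omega>"
    and "\<And>k. (\<integral>\<^sup>+\<omega>. ennreal (f k \<omega>) \<partial>M) \<le> ennreal (\<rho> ^ k * C)"
    and "0 \<le> \<rho>" and "\<rho> < 1" and "0 \<le> C"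
  shows "AE \<omega> in M. (\<lambda>k. f k \<omega>) \<longlonglongrightarrow> 0"
proof -
  have "(\<integral>\<^sup>+\<omega>. (\<Sum>k. ennreal (f k \<omega>)) \<partial>M) = (\<Sum>k. \<integral>\<^sup>+\<omega>. ennreal (f k \<omega>) \<partial>M)"
    using assms(1) by (intro nn_integral_suminf) auto
  also have "\<dots> \<le> (\<Sum>k. ennreal (\<rho> ^ k * C))"
    using assms(3) by (intro suminf_le) auto
  also have "\<dots> = ennreal (\<Sum>k. \<rho> ^ k * C)"
    using assms(4-6) by (intro suminf_ennreal2) (auto intro: summable_mult2 summable_geometric)
  also have "\<dots> < \<infinity>" by simp
  finally have "AE \<omega> in M. (\<Sum>k. ennreal (f k \<omega>)) \<noteq> \<infinity>"
    using assms(1) by (intro nn_integral_PInf_AE) auto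
  then show ?thesis
  proof eventually_elim
    case (elim \<omega>)
    then have "summable (\<lambda>k. f k \<omega>)"
      using assms(2) by (intro summable_suminf_not_top) auto
    then show ?case
      by (rule summable_LIMSEQ_zero)
  qed
qed

text \<open>A rate below 1, that is
  \<open>\<gamma> * (\<delta>\<^sup>2 - \<mu>\<^sup>2) < 2 * \<mu>\<close>, makes the geometric
  bounds summable. Almost sure convergence is asserted in that case only; the bound in expectation
  holds for every positive stepsize.\<close>

theorem theorem2:
  fixes D :: "'b measure"
    and A :: "'b \<Rightarrow> 'a::euclidean_space \<Rightarrow> 'a set"
    and M :: "'w measure" and F :: "nat \<Rightarrow> 'w measure"
    and \<xi> :: "nat \<Rightarrow> 'w \<Rightarrow> 'b"
    and a :: "nat \<Rightarrow> 'w \<Rightarrow> 'b \<Rightarrow> 'a"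
    and x :: "nat \<Rightarrow> 'w \<Rightarrow> 'a"
    and x0 xstar :: 'a
    and \<mu> \<delta> \<gamma> :: real
  assumes "prob_space D"
    and "\<mu> > 0"
    and "\<And>s. s \<in> space D \<Longrightarrow> strongly_maximally_monotone \<mu> (A s)"
    and "strongly_maximally_monotone \<mu> (expected_op D A)"
    and "\<And>z. 0 \<in> expected_op D A z \<longleftrightarrow> z = xstar"
    and "\<delta> > 0"
    and "expected_similarity D A xstar \<delta>"
    and "\<gamma> > 0"
    and "sppm_oc M F D A \<gamma> x0 \<xi> a x"
  shows "(\<forall>k. integrable M (\<lambda>\<omega>. (norm (x k \<omega> - xstar))\<^sup>2) \<and>
              prob_space.expectation M (\<lambda>\<omega>. (norm (x k \<omega> - xstar))\<^sup>2)
                \<le> ((1 + \<gamma>\<^sup>2 * \<delta>\<^sup>2) / (1 + \<gamma> * \<mu>)\<^sup>2) ^ k * (norm (x0 - xstar))\<^sup>2) \<and>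
         ((1 + \<gamma>\<^sup>2 * \<delta>\<^sup>2) / (1 + \<gamma> * \<mu>)\<^sup>2 < 1 \<longrightarrow>
            (AE \<omega> in M. (\<lambda>k. x k \<omega>) \<longlonglongrightarrow> xstar))"
proof -
  interpret sppm_oc M F D A \<gamma> x0 \<xi> a x by fact
  define \<rho> where "\<rho> = (1 + \<gamma>\<^sup>2 * \<delta>\<^sup>2) / (1 + \<gamma> * \<mu>)\<^sup>2"
  have "\<rho> \<ge> 0" by (simp add: \<rho>_def)
  have meas: "(\<lambda>\<omega>. (norm (x k \<omega> - xstar))\<^sup>2) \<in> borel_measurable M" for k
    using iterate_measurable[of k] by measurable
  have bound: "(\<integral>\<^sup>+\<omega>. ennreal ((norm (x k \<omega> - xstar))\<^sup>2) \<partial>M)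
      \<le> ennreal (\<rho> ^ k * (norm (x0 - xstar))\<^sup>2)" for k
    unfolding \<rho>_def using assms by (intro nn_integral_error_le) auto
  \<comment> \<open>Finiteness of the nonnegative integral gives integrability, so the
    \<open>expectation\<close> bounded next is not the default value 0.\<close>
  have int: "integrable M (\<lambda>\<omega>. (norm (x k \<omega> - xstar))\<^sup>2)" for k
    using meas bound[of k] by (intro integrableI_nonneg) (auto intro: le_less_trans)
  have "expectation (\<lambda>\<omega>. (norm (x k \<omega> - xstar))\<^sup>2) \<le> \<rho> ^ k * (norm (x0 - xstar))\<^sup>2" for k
    using bound[of k] \<open>\<rho> \<ge> 0\<close> by (simp add: nn_integral_eq_integral[OF int] ennreal_le_iff)
  moreover have "AE \<omega> in M. (\<lambda>k. x k \<omega>) \<longlonglongrightarrow> xstar" if "\<rho> < 1"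
  proof -
    have "AE \<omega> in M. (\<lambda>k. (norm (x k \<omega> - xstar))\<^sup>2) \<longlonglongrightarrow> 0"
      using meas bound \<open>\<rho> \<ge> 0\<close> that by (intro AE_tendsto_zero_if_integral_geometric[where C = "(norm (x0 - xstar))\<^sup>2"]) auto
    then show ?thesis
    proof eventually_elim
      case (elim \<omega>)
      then have "(\<lambda>k. norm (x k \<omega> - xstar)) \<longlonglongrightarrow> 0"
        using tendsto_real_sqrt[OF elim] by simp
      then show ?case
        by (simp add: LIM_zero_iff tendsto_norm_zero_iff)
    qed
  qed
  ultimately show ?thesis
    using int unfolding \<rho>_def by blast
qed

end
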